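(* Let $s\in\mathbb{N}_+$. There exists a constant $c>0$, independent of $f$ and $n$ (it may depend on $s$), such that the following holds. Let $f\in C^s[0,1]$ be real-valued with $f(0),f(1),f'(0),f'(1)\in\mathbb{Z}$ and $f^{(i)}(0)=f^{(i)}(1)=0$ for $i=2,\dots,s$. Suppose also that there exists $n_0\in\mathbb{N}_+$, $n_0\ge s$, such that \[ f\left(\frac{k}{n}\right)\ge f(0)+\frac{k}{n}\,f'(0),\quad k=1,\dots,s,\ n\ge n_0, \] \[ f\left(\frac{k}{n}\right)\ge f(1)-\left(1-\frac{k}{n}\right)f'(1),\quad k=n-s,\dots,n-1,\ n\ge n_0. \] Then for every $n\ge n_0$: if $s=1$, \[ \|(\widetilde{B}_n(f))'-f'\|\le c\left(\omega_\varphi^2(f',n^{-1/2})+\omega_1(f',n^{-1})+\frac1n\right), \] and if $s\ge 2$, \[ \|(\widetilde{B}_n(f))^{(s)}-f^{(s)}\|\le c\left(\omega_\varphi^2(f^{(s)},n^{-1/2})+\omega_1(f^{(s)},n^{-1})+\frac1n\,\|f^{(s)}\|+\frac1n\right). \]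
   Context: $\mathbb{N}_+$ is the set of positive integers. $\|\cdot\|$ is the sup-norm on $[0,1]$. $C^s[0,1]$ is the space of real functions with $s$ continuous derivatives on $[0,1]$ (one-sided at the endpoints). For real $\alpha$, $[\alpha]$ denotes the largest integer less than or equal to $\alpha$. For $f\in C[0,1]$, $n\in\mathbb{N}_+$, $x\in[0,1]$, \[ \widetilde{B}_n(f)(x):=\sum_{k=0}^n\left[f\left(\frac kn\right)\binom nk\right]x^k(1-x)^{n-k}. \] $\omega_1(F,t):=\sup\{|F(x)-F(y)|: x,y\in[0,1],\ |x-y|\le t\}$ is the ordinary modulus of continuity. $\omega_\varphi^2(F,t)$ is the Ditzian–Totik modulus of smoothness of second order in the uniform norm on $[0,1]$ with weight $\varphi(x):=\sqrt{x(1-x)}$: \[ \omega_\varphi^2(F,t):=\sup_{0<h\le t}\ \sup_{x}\left|F(x+h\varphi(x))-2F(x)+F(x-h\varphi(x))\right|, \] where the inner supremum is over $x\in[0,1]$ with $x\pm h\varphi(x)\in[0,1]$. *)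

theory Defs
  imports "HOL-Analysis.Analysis"
begin

text \<open>
  Functions on \<open>[0,1]\<close> are rendered as total functions \<open>real \<Rightarrow> real\<close> of which only the
  values on \<open>{0..1}\<close> matter. Derivatives are taken within \<open>{0..1}\<close>, hence are one-sided at
  the endpoints.
\<close>

fun deriv01 :: "nat \<Rightarrow> (real \<Rightarrow> real) \<Rightarrow> real \<Rightarrow> real" where
  "deriv01 0 f = f"
| "deriv01 (Suc k) f = (\<lambda>x. vector_derivative (deriv01 k f) (at x within {0..1}))"

definition C01 :: "nat \<Rightarrow> (real \<Rightarrow> real) set" where
  "C01 s = {f. (\<forall>k<s. deriv01 k f differentiable_on {0..1}) \<and>
               continuous_on {0..1} (deriv01 s f)}"

text \<open>
  The suprema below are taken in the conditionally complete lattice \<open>real\<close>, so they are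
  meaningful for bounded functions (in particular for functions continuous on \<open>{0..1}\<close>).
\<close>

definition norm01 :: "(real \<Rightarrow> real) \<Rightarrow> real" where
  "norm01 F = (SUP x\<in>{0..1}. \<bar>F x\<bar>)"

definition omega1 :: "(real \<Rightarrow> real) \<Rightarrow> real \<Rightarrow> real" where
  "omega1 F t = Sup {\<bar>F x - F y\<bar> | x y. x \<in> {0..1} \<and> y \<in> {0..1} \<and> \<bar>x - y\<bar> \<le> t}"

definition phi :: "real \<Rightarrow> real" where
  "phi x = sqrt (x * (1 - x))"

definition omega2_phi :: "(real \<Rightarrow> real) \<Rightarrow> real \<Rightarrow> real" where
  "omega2_phi F t =
     (SUP h\<in>{0<..t}.
        SUP x\<in>{x\<in>{0..1}. x + h * phi x \<in> {0..1} \<and> x - h * phi x \<in> {0..1}}.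
          \<bar>F (x + h * phi x) - 2 * F x + F (x - h * phi x)\<bar>)"

definition int_Bernstein :: "nat \<Rightarrow> (real \<Rightarrow> real) \<Rightarrow> real \<Rightarrow> real" where
  "int_Bernstein n f x =
     (\<Sum>k=0..n. real_of_int \<lfloor>f (real k / real n) * real (n choose k)\<rfloor> * x ^ k * (1 - x) ^ (n - k))"

end

theory Submission
  imports Defs "HOL-Real_Asymp.Real_Asymp"
begin

text \<open>
  Let \<open>F\<close> be the derivative of order \<open>s\<close> of \<open>f\<close>. Differentiating a polynomial in Bernstein form of degree \<open>n\<close>
  \<open>s\<close> times gives the form of degree \<open>n - s\<close> whose coefficients are the \<open>s\<close>-th forward differences, times
  \<open>n * (n - 1) * \<dots> * (n - s + 1)\<close> (\<open>deriv01_bernform\<close>). Since forward differences are values of \<open>F\<close> at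
  intermediate points, the derivative of the ordinary Bernstein polynomial of \<open>f\<close> is close to the Bernstein
  polynomial of \<open>F\<close> of degree \<open>n - s\<close>: moving the intermediate points to the nodes costs the first modulus
  at \<open>1 / n\<close>, and normalising the product to \<open>n ^ s\<close> costs the norm of \<open>F\<close> times \<open>s * (s - 1) / n\<close>
  (\<open>fwd_diff_vs_derivative\<close>).

  That the Bernstein polynomial of \<open>F\<close> is close to \<open>F\<close> in terms of the Ditzian--Totik modulus
  (\<open>bernform_ditzian_totik\<close>) is shown by a convexity argument in place of K-functionals. The negative
  entropy \<open>q u = u * ln u + (1 - u) * ln (1 - u)\<close> has second derivative \<open>1 / (phi u)\<^sup>2\<close>. If all second
  differences of \<open>F\<close> with steps up to \<open>t * phi y\<close> are below \<open>w\<close> in absolute value, then \<open>F + (w / t\<^sup>2) * q\<close> has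
  positive second differences at full step, and a maximum argument shows that it lies below its chords
  up to the error \<open>w\<close> (\<open>approx_convexI\<close>). Jensen's inequality then applies up to \<open>w\<close>, and the Bernstein
  operator of degree \<open>m\<close> raises \<open>q\<close> by at most \<open>1 / m\<close> (\<open>bernform_negentropy_le\<close>). With \<open>t\<^sup>2 = 1 / n\<close> both
  losses are of order \<open>w\<close>.

  Finally, rounding the coefficients down is harmless after \<open>s\<close> differentiations, which magnify errors in
  the values \<open>f (k / n)\<close> by at most \<open>(2 * n) ^ s\<close>. In the middle the binomial coefficients are so large that
  the rounding error contributes \<open>O(1 / n)\<close>. Near an end point, the arithmetic hypotheses make the tangent
  there an admissible integer lower bound for the rounded coefficients, and the Taylor remainder above the
  tangent is controlled by the first modulus of \<open>F\<close> (\<open>floor_error_bound\<close>).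
\<close>

section \<open>Polynomials in Bernstein form\<close>

definition bernform :: "nat \<Rightarrow> (nat \<Rightarrow> real) \<Rightarrow> real \<Rightarrow> real" where
  "bernform n a x = (\<Sum>k\<le>n. a k * Bernstein n k x)"

lemma bernform_affine:
  assumes "n > 0"
  shows "bernform n (\<lambda>k. \<alpha> + \<beta> * (real k / real n)) x = \<alpha> + \<beta> * x"
proof -
  have "bernform n (\<lambda>k. \<alpha> + \<beta> * (real k / real n)) x =
        \<alpha> * (\<Sum>k\<le>n. Bernstein n k x) + \<beta> / real n * (\<Sum>k\<le>n. real k * Bernstein n k x)"
    unfolding bernform_def sum_distrib_left sum.distrib[symmetric]
    by (intro sum.cong) (auto simp: algebra_simps)
  then show ?thesis using assms by simp
qed

lemma bernform_variance:
  assumes "n > 0"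
  shows "bernform n (\<lambda>k. (real k / real n - x)\<^sup>2) x = x * (1 - x) / real n"
proof -
  have "bernform n (\<lambda>k. (real k / real n - x)\<^sup>2) x =
        1 / (real n)\<^sup>2 * (\<Sum>k\<le>n. real k * (real k - 1) * Bernstein n k x)
        + (1 / (real n)\<^sup>2 - 2 * x / real n) * (\<Sum>k\<le>n. real k * Bernstein n k x)
        + x\<^sup>2 * (\<Sum>k\<le>n. Bernstein n k x)"
    unfolding bernform_def sum_distrib_left sum.distrib[symmetric]
    using assms by (intro sum.cong refl) (simp add: field_simps power2_eq_square)
  also have "\<dots> = x * (1 - x) / real n"
    using assms by (simp only: sum_Bernstein sum_k_Bernstein sum_kk_Bernstein)
      (simp add: field_simps power2_eq_square)
  finally show ?thesis .
qed

lemma bernform_mono: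
  assumes "x \<in> {0..1}" and "\<And>k. k \<le> n \<Longrightarrow> a k \<le> b k"
  shows "bernform n a x \<le> bernform n b x"
  unfolding bernform_def using assms
  by (intro sum_mono mult_right_mono Bernstein_nonneg) auto

lemma bernform_linear:
  "bernform n (\<lambda>k. \<alpha> * a k + \<beta> * b k) x = \<alpha> * bernform n a x + \<beta> * bernform n b x"
  unfolding bernform_def sum_distrib_left sum.distrib[symmetric]
  by (intro sum.cong refl) (simp add: algebra_simps)

lemma bernform_const: "bernform n (\<lambda>k. c) x = c"
  unfolding bernform_def by (simp flip: sum_distrib_left)

lemma bernform_0: "bernform n a 0 = a 0"
proof -
  have "bernform n a 0 = (\<Sum>k\<le>n. if k = 0 then a k else 0)"
    unfolding bernform_def Bernstein_def by (intro sum.cong) (auto simp: power_0_left)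
  then show ?thesis by simp
qed

lemma bernform_1: "bernform n a 1 = a n"
proof -
  have "bernform n a 1 = (\<Sum>k\<le>n. if k = n then a k else 0)"
    unfolding bernform_def Bernstein_def by (intro sum.cong) (auto simp: power_0_left)
  then show ?thesis by simp
qed

lemma abs_bernform_diff_le:
  assumes "x \<in> {0..1}" and "\<And>k. k \<le> n \<Longrightarrow> \<bar>a k - b k\<bar> \<le> M"
  shows "\<bar>bernform n a x - bernform n b x\<bar> \<le> M"
proof -
  have eq: "bernform n a x - bernform n b x = bernform n (\<lambda>k. a k - b k) x"
    using bernform_linear[of n 1 a "-1" b x] by simp
  have "bernform n (\<lambda>k. a k - b k) x \<le> bernform n (\<lambda>k. M) x"
       "bernform n (\<lambda>k. - M) x \<le> bernform n (\<lambda>k. a k - b k) x"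
    using assms by (force intro!: bernform_mono simp: abs_le_iff)+
  then show ?thesis unfolding eq bernform_const by linarith
qed

section \<open>Negative entropy as a comparison function\<close>

definition xlnx :: "real \<Rightarrow> real" where "xlnx u = u * ln u"

lemma continuous_on_xlnx: "continuous_on {0..} xlnx"
proof -
  have "(xlnx \<longlongrightarrow> xlnx x) (at x within {0..})" if "x \<ge> 0" for x
  proof (cases "x = 0")
    case True
    have "at x within {0..} = at_right (0::real)"
      unfolding True by (rule at_within_Ici_at_right)
    moreover have "((\<lambda>u::real. u * ln u) \<longlongrightarrow> 0) (at_right 0)" by real_asymp
    ultimately show ?thesis using True by (simp add: xlnx_def[abs_def])
  next
    case False
    then show ?thesis using that unfolding xlnx_def[abs_def] by (intro tendsto_intros) auto
  qed
  then show ?thesis unfolding continuous_on_def by auto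
qed

lemma has_real_derivative_xlnx:
  assumes "(f has_real_derivative D) (at v)" "0 < f v"
  shows "((\<lambda>v. xlnx (f v)) has_real_derivative (ln (f v) + 1) * D) (at v)"
  unfolding xlnx_def using assms by (auto intro!: derivative_eq_intros simp: algebra_simps)

text \<open>
  As functions of \<open>\<delta>\<close>, both sides and their first derivatives vanish at \<open>0\<close>, and the second
  derivative on the right, \<open>1 / (y + \<delta>) + 1 / (y - \<delta>)\<close>, is at least \<open>2 / y\<close> because \<open>1 / u\<close> is convex. Differentiating twice
  inside the open interval avoids the singularity of \<open>ln\<close> at the end \<open>\<delta> = y\<close>.
\<close>
lemma xlnx_second_difference:
  assumes y: "0 < y" and d: "0 \<le> \<delta>" "\<delta> \<le> y"
  shows "\<delta>\<^sup>2 / y \<le> xlnx (y + \<delta>) - 2 * xlnx y + xlnx (y - \<delta>)"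
proof -
  define g where "g v = xlnx (y + v) - 2 * xlnx y + xlnx (y - v) - v\<^sup>2 / y" for v
  have "g 0 \<le> g \<delta>"
  proof (cases "\<delta> = 0")
    case False
    show ?thesis
    proof (rule DERIV_nonneg_imp_increasing_open[where f = g and a = 0 and b = \<delta>])
      show "0 \<le> \<delta>" by fact
      show "continuous_on {0..\<delta>} g" unfolding g_def
        using y d by (intro continuous_intros continuous_on_compose2[OF continuous_on_xlnx]) auto
      fix v assume v: "0 < v" "v < \<delta>"
      then have p: "y + v > 0" "y - v > 0" using d y by auto
      have "(g has_real_derivative ln (y + v) - ln (y - v) - 2 * v / y) (at v)"
        unfolding g_def using p y by (auto intro!: derivative_eq_intros has_real_derivative_xlnx)
      moreover have "2 * v / y \<le> ln (y + v) - ln (y - v)"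
      proof -
        define h where "h v = ln (y + v) - ln (y - v) - 2 * v / y" for v
        have "h 0 \<le> h v"
        proof (rule DERIV_nonneg_imp_nondecreasing[where f = h and a = 0 and b = v])
          fix w assume w: "0 \<le> w" "w \<le> v"
          then have p: "y + w > 0" "y - w > 0" using v d y by auto
          have "(h has_real_derivative 1 / (y + w) + 1 / (y - w) - 2 / y) (at w)"
            unfolding h_def using p y by (auto intro!: derivative_eq_intros)
          moreover have "0 \<le> 1 / (y + w) + 1 / (y - w) - 2 / y"
          proof -
            have "1 / (y + w) + 1 / (y - w) - 2 / y = 2 * w\<^sup>2 / (y * (y + w) * (y - w))"
              using p y by (simp add: divide_simps) (simp add: algebra_simps power2_eq_square)
            then show ?thesis using p y by simp
          qed
          ultimately show "\<exists>D. (h has_real_derivative D) (at w) \<and> 0 \<le> D" by blast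
        qed (use v in auto)
        then show ?thesis unfolding h_def by simp
      qed
      ultimately show "\<exists>D. (g has_real_derivative D) (at v) \<and> 0 \<le> D" by auto
    qed
  qed simp
  then show ?thesis unfolding g_def by simp
qed

text \<open>
  The second derivative of this function is \<open>1 / (u * (1 - u))\<close>, the reciprocal of \<open>(phi u)\<^sup>2\<close>. Hence its
  second difference with the variable step \<open>h * phi u\<close> is at least \<open>h\<^sup>2\<close>, for every \<open>u\<close>: it is the natural
  strictly convex function for the Ditzian--Totik modulus.
\<close>
definition negentropy :: "real \<Rightarrow> real" where
  "negentropy u = xlnx u + xlnx (1 - u)"

lemma continuous_on_negentropy: "continuous_on {0..1} negentropy"
  unfolding negentropy_def[abs_def]
  by (intro continuous_intros continuous_on_compose2[OF continuous_on_xlnx]) auto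

lemma negentropy_second_difference:
  assumes "0 < y" "y < 1" "0 \<le> \<delta>" "y + \<delta> \<in> {0..1}" "y - \<delta> \<in> {0..1}"
  shows "\<delta>\<^sup>2 / (y * (1 - y)) \<le> negentropy (y + \<delta>) - 2 * negentropy y + negentropy (y - \<delta>)"
proof -
  have "\<delta>\<^sup>2 / y + \<delta>\<^sup>2 / (1 - y) \<le> negentropy (y + \<delta>) - 2 * negentropy y + negentropy (y - \<delta>)"
    using xlnx_second_difference[of y \<delta>] xlnx_second_difference[of "1 - y" \<delta>] assms
    unfolding negentropy_def by (simp add: algebra_simps)
  moreover have "\<delta>\<^sup>2 / y + \<delta>\<^sup>2 / (1 - y) = \<delta>\<^sup>2 / (y * (1 - y))"
    using assms by (simp add: field_simps)
  ultimately show ?thesis by simp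
qed

lemma xlnx_le:
  assumes "0 < x" "0 \<le> u"
  shows "xlnx u \<le> u * ln x + u * (u - x) / x"
proof (cases "u = 0")
  case False
  then have "u * (ln u - ln x) \<le> u * ((u - x) / x)"
    using assms ln_diff_le[of u x] by (intro mult_left_mono) auto
  then show ?thesis unfolding xlnx_def by (simp add: algebra_simps)
qed (simp add: xlnx_def)

text \<open>
  The difference of \<open>negentropy u\<close> and the first summand is the relative entropy of the two-point
  distributions with parameters \<open>u\<close> and \<open>x\<close>; it is bounded by their chi-square distance. The point is
  that the right-hand side is a quadratic polynomial in \<open>u\<close>, on which the Bernstein operator is explicit.
\<close>
lemma negentropy_le:
  assumes "0 < x" "x < 1" "u \<in> {0..1}"
  shows "negentropy u \<le> (u * ln x + (1 - u) * ln (1 - x)) + (u - x)\<^sup>2 / (x * (1 - x))"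
proof -
  have "u * (u - x) / x + (1 - u) * (x - u) / (1 - x) = (u - x)\<^sup>2 / (x * (1 - x))"
    using assms by (simp add: divide_simps) (simp add: algebra_simps power2_eq_square)
  then show ?thesis
    using xlnx_le[of x u] xlnx_le[of "1 - x" "1 - u"] assms unfolding negentropy_def by simp
qed

text \<open>
  The quadratic majorant touches the negative entropy at \<open>x\<close>, so only the variance \<open>x * (1 - x) / m\<close> is
  left, and the factor \<open>1 / (x * (1 - x))\<close> cancels it. There is no loss near the end points.
\<close>
lemma bernform_negentropy_le:
  assumes "m > 0" and x: "0 < x" "x < 1"
  shows "bernform m (\<lambda>k. negentropy (real k / real m)) x \<le> negentropy x + 1 / real m"
proof -
  define p where "p = 1 / (x * (1 - x))"
  have "bernform m (\<lambda>k. negentropy (real k / real m)) x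
     \<le> bernform m (\<lambda>k. 1 * (ln (1 - x) + (ln x - ln (1 - x)) * (real k / real m))
                      + p * (real k / real m - x)\<^sup>2) x"
  proof (rule bernform_mono)
    fix k assume "k \<le> m"
    then have "real k / real m \<in> {0..1}" using assms by auto
    from negentropy_le[OF x this]
    show "negentropy (real k / real m) \<le> 1 * (ln (1 - x) + (ln x - ln (1 - x)) * (real k / real m))
                      + p * (real k / real m - x)\<^sup>2"
      by (simp add: algebra_simps p_def)
  qed (use x in auto)
  also have "\<dots> = 1 * (ln (1 - x) + (ln x - ln (1 - x)) * x) + p * (x * (1 - x) / real m)"
    by (simp only: bernform_linear bernform_affine[OF \<open>m > 0\<close>] bernform_variance[OF \<open>m > 0\<close>])
  also have "\<dots> = negentropy x + 1 / real m"
    using x unfolding p_def negentropy_def xlnx_def by (simp add: algebra_simps)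
  finally show ?thesis .
qed

section \<open>The direct estimate by the Ditzian--Totik modulus\<close>

text \<open>
  Strict midpoint convexity at one variable scale \<open>r\<close>, and second differences at least \<open>- w\<close> below that
  scale, imply convexity up to the error \<open>w\<close>. Let \<open>y\<close> be a maximum point of the difference \<open>D\<close> of \<open>A\<close>
  and its chord, with \<open>D y > 0\<close>. A full step at \<open>y\<close> that stays inside \<open>[a, b]\<close> would have
  a nonpositive second difference, which is excluded. So an end point of the interval is reached by a
  shorter step, where \<open>D\<close> vanishes; the other neighbour is at most \<open>D y\<close>, so the second difference
  is at most \<open>- D y\<close>, which forces \<open>D y \<le> w\<close>.
\<close>
lemma approx_convexI:
  fixes A r :: "real \<Rightarrow> real"
  assumes cont: "continuous_on {a..b} A" and w: "0 \<le> w" and ab: "a < b" and x: "x \<in> {a..b}"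
    and small: "\<And>y \<delta>. \<lbrakk>y \<in> {a<..<b}; 0 < \<delta>; \<delta> \<le> r y; y + \<delta> \<in> {a..b}; y - \<delta> \<in> {a..b}\<rbrakk>
                  \<Longrightarrow> - w \<le> A (y + \<delta>) - 2 * A y + A (y - \<delta>)"
    and full: "\<And>y. \<lbrakk>y \<in> {a<..<b}; y + r y \<in> {a..b}; y - r y \<in> {a..b}\<rbrakk>
                  \<Longrightarrow> 0 < A (y + r y) - 2 * A y + A (y - r y)"
    and r: "\<And>y. y \<in> {a<..<b} \<Longrightarrow> 0 < r y"
  shows "A x \<le> A a + (A b - A a) / (b - a) * (x - a) + w"
proof -
  define \<sigma> where "\<sigma> = (A b - A a) / (b - a)"
  define D where "D y = A y - (A a + \<sigma> * (y - a))" for y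
  have Dab: "D a = 0" "D b = 0" using ab by (auto simp: D_def \<sigma>_def)
  have second: "D (y + \<delta>) - 2 * D y + D (y - \<delta>) = A (y + \<delta>) - 2 * A y + A (y - \<delta>)" for y \<delta>
    unfolding D_def by (simp add: algebra_simps)
  have "continuous_on {a..b} D" unfolding D_def by (intro continuous_intros cont)
  then obtain y where y: "y \<in> {a..b}" and max: "\<And>z. z \<in> {a..b} \<Longrightarrow> D z \<le> D y"
    using continuous_attains_sup[of "{a..b}" D] ab by auto
  have "D y \<le> w"
  proof (rule ccontr)
    assume "\<not> D y \<le> w"
    then have Dy: "D y > w" by simp
    then have "y \<noteq> a" "y \<noteq> b" using w Dab by auto
    then have y': "y \<in> {a<..<b}" using y by auto
    define \<delta> where "\<delta> = min (r y) (min (y - a) (b - y))"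
    have \<delta>: "0 < \<delta>" "\<delta> \<le> r y" "y + \<delta> \<in> {a..b}" "y - \<delta> \<in> {a..b}"
      using r[OF y'] y' by (auto simp: \<delta>_def)
    show False
    proof (cases "\<delta> = r y")
      case True
      then show False using full[OF y'] \<delta> max[of "y + r y"] max[of "y - r y"] second[of y "r y"]
        by auto
    next
      case False
      then have "y + \<delta> = b \<or> y - \<delta> = a" by (auto simp: \<delta>_def min_def split: if_splits)
      then have "D (y + \<delta>) = 0 \<or> D (y - \<delta>) = 0" using Dab by auto
      then have "D (y + \<delta>) + D (y - \<delta>) \<le> D y" using max[OF \<delta>(3)] max[OF \<delta>(4)] by auto
      then show False using small[OF y' \<delta>] second[of y \<delta>] Dy by linarith
    qed
  qed
  then show ?thesis using max[OF x] unfolding D_def \<sigma>_def by linarith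
qed

text \<open>
  The chord condition says that every slope from a point on the left of \<open>x\<close> up to the lowered point
  \<open>(x, A x - w)\<close> is at most every slope from that point to a point on the right; the supremum of the
  left slopes separates the two families.
\<close>
lemma approx_supporting_line:
  fixes A :: "real \<Rightarrow> real"
  assumes "a < x" "x < b"
    and chord: "\<And>p q. \<lbrakk>p \<in> {a..<x}; q \<in> {x<..b}\<rbrakk>
                  \<Longrightarrow> A x \<le> A p + (A q - A p) / (q - p) * (x - p) + w" and w: "0 \<le> w"
  obtains \<sigma> where "\<And>z. z \<in> {a..b} \<Longrightarrow> A x - w + \<sigma> * (z - x) \<le> A z"
proof -
  define S where "S = (\<lambda>p. (A x - w - A p) / (x - p)) ` {a..<x}"
  have sep: "(A x - w - A p) / (x - p) \<le> (A q - (A x - w)) / (q - x)"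
    if p: "p \<in> {a..<x}" and q: "q \<in> {x<..b}" for p q
  proof -
    have pos: "0 < x - p" "0 < q - x" "0 < q - p" using p q by auto
    have "(A x - w - A p) * (q - p) \<le> (A q - A p) * (x - p)"
      using chord[OF p q] pos by (simp add: field_simps)
    then have "(A x - w - A p) * (q - x) \<le> (A q - (A x - w)) * (x - p)"
      by (simp add: algebra_simps)
    then show ?thesis using pos by (simp add: frac_le_eq divide_simps mult.commute)
  qed
  have ne: "S \<noteq> {}" using assms unfolding S_def by auto
  have bdd: "bdd_above S"
    using sep[of _ b] assms unfolding S_def by (intro bdd_aboveI2[of _ _ "(A b - (A x - w)) / (b - x)"]) auto
  show thesis
  proof (rule that[of "Sup S"])
    fix z assume z: "z \<in> {a..b}"
    consider "z < x" | "z = x" | "z > x" by linarith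
    then show "A x - w + Sup S * (z - x) \<le> A z"
    proof cases
      case 1
      then have "(A x - w - A z) / (x - z) \<le> Sup S"
        using z bdd by (intro cSup_upper) (auto simp: S_def)
      then show ?thesis using 1 by (simp add: field_simps)
    next
      case 2
      then show ?thesis using w by simp
    next
      case 3
      then have "Sup S \<le> (A z - (A x - w)) / (z - x)"
        using z sep ne by (intro cSup_least) (auto simp: S_def)
      then show ?thesis using 3 by (simp add: field_simps)
    qed
  qed
qed

text \<open>
  The second difference of the negative entropy at full step \<open>t * phi y\<close> is at least \<open>t\<^sup>2\<close>. Adding it with
  the factor \<open>w / t\<^sup>2\<close> therefore outweighs second differences of \<open>F\<close> above \<open>- w\<close>, so the sum \<open>A\<close> is
  convex up to \<open>w\<close>. Jensen's inequality for the Bernstein operator, which reproduces affine functions, loses \<open>w\<close>; the negative entropy itself loses \<open>w / (m * t\<^sup>2)\<close>.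
\<close>
lemma bernform_lower_bound:
  fixes F :: "real \<Rightarrow> real"
  assumes cont: "continuous_on {0..1} F" and t: "0 < t" and m: "0 < m" and w: "0 < w"
    and x: "0 < x" "x < 1"
    and step: "\<And>y h. \<lbrakk>0 < h; h \<le> t; y \<in> {0..1}; y + h * phi y \<in> {0..1}; y - h * phi y \<in> {0..1}\<rbrakk>
                 \<Longrightarrow> \<bar>F (y + h * phi y) - 2 * F y + F (y - h * phi y)\<bar> < w"
  shows "F x - w * (1 + 1 / (real m * t\<^sup>2)) \<le> bernform m (\<lambda>k. F (real k / real m)) x"
proof -
  define A where "A u = F u + w / t\<^sup>2 * negentropy u" for u
  have contA: "continuous_on {0..1} A"
    unfolding A_def by (intro continuous_intros cont continuous_on_negentropy)
  have chord: "A x \<le> A p + (A q - A p) / (q - p) * (x - p) + w"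
    if pq: "p \<in> {0..<x}" "q \<in> {x<..1}" for p q
  proof (rule approx_convexI[where r = "\<lambda>y. t * phi y"])
    show "continuous_on {p..q} A" using pq by (intro continuous_on_subset[OF contA]) auto
    show "0 \<le> w" "p < q" "x \<in> {p..q}" using w pq by auto
  next
    fix y assume y: "y \<in> {p<..<q}"
    then have y01: "0 < y" "y < 1" using pq by auto
    then have phi: "0 < phi y" "(phi y)\<^sup>2 = y * (1 - y)" by (auto simp: phi_def)
    show "0 < t * phi y" using t phi by simp
    {
      fix \<delta> assume \<delta>: "0 < \<delta>" "\<delta> \<le> t * phi y" "y + \<delta> \<in> {p..q}" "y - \<delta> \<in> {p..q}"
      have "\<bar>F (y + \<delta>) - 2 * F y + F (y - \<delta>)\<bar> < w"
        using step[of "\<delta> / phi y" y] \<delta> y01 phi pq by (auto simp: field_simps)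
      moreover have "w / t\<^sup>2 * (\<delta>\<^sup>2 / (phi y)\<^sup>2)
          \<le> w / t\<^sup>2 * (negentropy (y + \<delta>) - 2 * negentropy y + negentropy (y - \<delta>))"
        unfolding phi using \<delta> y01 pq w
        by (intro mult_left_mono negentropy_second_difference) auto
      ultimately have "w / t\<^sup>2 * (\<delta>\<^sup>2 / (phi y)\<^sup>2) - w < A (y + \<delta>) - 2 * A y + A (y - \<delta>)"
        unfolding A_def by (simp add: algebra_simps abs_less_iff)
    } note * = this
    show "0 < A (y + t * phi y) - 2 * A y + A (y - t * phi y)"
      if "y + t * phi y \<in> {p..q}" "y - t * phi y \<in> {p..q}"
    proof -
      have "w / t\<^sup>2 * ((t * phi y)\<^sup>2 / (phi y)\<^sup>2) = w"
        using t phi(1) by (simp add: power_mult_distrib)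
      then show ?thesis using *[of "t * phi y"] that t phi(1) by simp
    qed
    show "- w \<le> A (y + \<delta>) - 2 * A y + A (y - \<delta>)"
      if "0 < \<delta>" "\<delta> \<le> t * phi y" "y + \<delta> \<in> {p..q}" "y - \<delta> \<in> {p..q}" for \<delta>
    proof -
      have "0 \<le> w / t\<^sup>2 * (\<delta>\<^sup>2 / (phi y)\<^sup>2)" using w by simp
      then show ?thesis using *[OF that] by linarith
    qed
  qed
  obtain \<sigma> where \<sigma>: "\<And>z. z \<in> {0..1} \<Longrightarrow> A x - w + \<sigma> * (z - x) \<le> A z"
    using approx_supporting_line[OF x chord] w by auto
  have "A x - w = bernform m (\<lambda>k. (A x - w - \<sigma> * x) + \<sigma> * (real k / real m)) x"
    unfolding bernform_affine[OF m] by simp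
  also have "\<dots> \<le> bernform m (\<lambda>k. A (real k / real m)) x"
  proof (rule bernform_mono)
    fix k assume "k \<le> m"
    then show "(A x - w - \<sigma> * x) + \<sigma> * (real k / real m) \<le> A (real k / real m)"
      using \<sigma>[of "real k / real m"] m by (simp add: algebra_simps)
  qed (use x in auto)
  also have "\<dots> = bernform m (\<lambda>k. F (real k / real m)) x
                + w / t\<^sup>2 * bernform m (\<lambda>k. negentropy (real k / real m)) x"
    using bernform_linear[of m 1 "\<lambda>k. F (real k / real m)" "w / t\<^sup>2"] by (simp add: A_def)
  also have "w / t\<^sup>2 * bernform m (\<lambda>k. negentropy (real k / real m)) x
             \<le> w / t\<^sup>2 * (negentropy x + 1 / real m)"
    using w by (intro mult_left_mono bernform_negentropy_le m x) auto
  finally have "A x - w \<le> bernform m (\<lambda>k. F (real k / real m)) x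
                + w / t\<^sup>2 * (negentropy x + 1 / real m)" by simp
  moreover have "w * (1 + 1 / (real m * t\<^sup>2)) = w + w / t\<^sup>2 * (1 / real m)"
    by (simp add: distrib_left mult.commute)
  ultimately show ?thesis unfolding A_def by (simp only: distrib_left)
qed

text \<open>
  Continuity bounds all second differences, which makes both nested real suprema genuine upper bounds.
\<close>
lemma omega2_phi_upper:
  assumes cont: "continuous_on {0..1} F" and h: "0 < h" "h \<le> t"
    and y: "y \<in> {0..1}" "y + h * phi y \<in> {0..1}" "y - h * phi y \<in> {0..1}"
  shows "\<bar>F (y + h * phi y) - 2 * F y + F (y - h * phi y)\<bar> \<le> omega2_phi F t"
proof -
  define adm where "adm h = {x\<in>{0..1}. x + h * phi x \<in> {0..1} \<and> x - h * phi x \<in> {0..1}}" for h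
  define d where "d h x = \<bar>F (x + h * phi x) - 2 * F x + F (x - h * phi x)\<bar>" for h x
  obtain M where M: "\<And>x. x \<in> {0..1} \<Longrightarrow> \<bar>F x\<bar> \<le> M"
    using compact_imp_bounded[OF compact_continuous_image[OF cont compact_Icc]]
    unfolding bounded_iff by (metis imageI real_norm_def)
  have d: "d h x \<le> 4 * M" if "x \<in> adm h" for h x
    using M[of x] M[of "x + h * phi x"] M[of "x - h * phi x"] that
    unfolding d_def adm_def by auto
  have ne: "0 \<in> adm h" for h by (auto simp: adm_def phi_def)
  have bdd: "bdd_above (d h ` adm h)" for h using d by (intro bdd_aboveI2) auto
  have "(SUP x\<in>adm h. d h x) \<le> 4 * M" for h
    using ne[of h] by (intro cSUP_least d) auto
  then have bdd': "bdd_above ((\<lambda>h. SUP x\<in>adm h. d h x) ` {0<..t})"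
    by (intro bdd_aboveI2)
  have "d h y \<le> (SUP x\<in>adm h. d h x)"
    using y by (intro cSUP_upper bdd) (auto simp: adm_def)
  also have "\<dots> \<le> (SUP h\<in>{0<..t}. SUP x\<in>adm h. d h x)"
    using h by (intro cSUP_upper[OF _ bdd']) auto
  finally show ?thesis unfolding omega2_phi_def d_def adm_def .
qed

text \<open>
  The two-sided estimate is the one-sided one for \<open>F\<close> and for \<open>- F\<close>. That estimate needs a strict bound
  \<open>w\<close> for the second differences, hence the detour through an arbitrary \<open>e > 0\<close>.
\<close>
theorem bernform_ditzian_totik:
  assumes cont: "continuous_on {0..1} F" and t: "0 < t" and m: "0 < m" and x: "x \<in> {0..1}"
  shows "\<bar>bernform m (\<lambda>k. F (real k / real m)) x - F x\<bar> \<le> (1 + 1 / (real m * t\<^sup>2)) * omega2_phi F t"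
proof -
  define K where "K = 1 + 1 / (real m * t\<^sup>2)"
  have K: "K \<ge> 1" by (simp add: K_def)
  have "\<bar>F (0 + t * phi 0) - 2 * F 0 + F (0 - t * phi 0)\<bar> \<le> omega2_phi F t"
    using t by (intro omega2_phi_upper cont) (auto simp: phi_def)
  then have w0: "0 \<le> omega2_phi F t" by linarith
  consider "x = 0" | "x = 1" | "0 < x" "x < 1" using x by fastforce
  then show ?thesis
  proof cases
    case 3
    have "\<bar>bernform m (\<lambda>k. F (real k / real m)) x - F x\<bar> \<le> K * omega2_phi F t + e" if e: "e > 0" for e
    proof -
      define w where "w = omega2_phi F t + e / K"
      have w: "w > omega2_phi F t" "w > 0" using e K w0 by (auto simp: w_def add_nonneg_pos)
      have step: "\<bar>F (y + h * phi y) - 2 * F y + F (y - h * phi y)\<bar> < w"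
        if "0 < h" "h \<le> t" "y \<in> {0..1}" "y + h * phi y \<in> {0..1}" "y - h * phi y \<in> {0..1}" for y h
        using omega2_phi_upper[OF cont that] w by linarith
      have "F x - w * K \<le> bernform m (\<lambda>k. F (real k / real m)) x"
        unfolding K_def by (intro bernform_lower_bound step cont t m w 3)
      moreover have "- F x - w * K \<le> bernform m (\<lambda>k. - F (real k / real m)) x"
        unfolding K_def
      proof (intro bernform_lower_bound[where F = "\<lambda>x. - F x"] t m w 3 continuous_intros cont)
        fix y h assume "0 < h" "h \<le> t" "y \<in> {0..1}" "y + h * phi y \<in> {0..1}" "y - h * phi y \<in> {0..1}"
        from step[OF this] show "\<bar>- F (y + h * phi y) - 2 * - F y + - F (y - h * phi y)\<bar> < w"
          by linarith
      qed
      moreover have "bernform m (\<lambda>k. - F (real k / real m)) x = - bernform m (\<lambda>k. F (real k / real m)) x"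
        using bernform_linear[of m "-1" "\<lambda>k. F (real k / real m)" 0] by simp
      moreover have "w * K = K * omega2_phi F t + e" using K by (simp add: w_def algebra_simps)
      ultimately show ?thesis by linarith
    qed
    then show ?thesis unfolding K_def[symmetric] by (rule field_le_epsilon)
  qed (use m K w0 in \<open>auto simp: bernform_0 bernform_1 K_def\<close>)
qed

section \<open>Derivatives of polynomials in Bernstein form\<close>

definition fwd_diff :: "(nat \<Rightarrow> real) \<Rightarrow> nat \<Rightarrow> real" where
  "fwd_diff a k = a (Suc k) - a k"

text \<open>
  De Casteljau's recursion, that is, Pascal's rule for the Bernstein basis. It makes the derivative
  formula below a plain induction on the degree.
\<close>
lemma bernform_Suc:
  "bernform (Suc m) a x = (1 - x) * bernform m a x + x * bernform m (\<lambda>k. a (Suc k)) x"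
proof -
  have B0: "Bernstein (Suc m) 0 x = (1 - x) * Bernstein m 0 x"
    by (simp add: Bernstein_def)
  have BS: "Bernstein (Suc m) (Suc k) x = x * Bernstein m k x + (1 - x) * Bernstein m (Suc k) x"
    if "k \<le> m" for k
  proof (cases "k = m")
    case False
    then have "m - k = Suc (m - Suc k)" using that by simp
    then show ?thesis by (simp add: Bernstein_def algebra_simps)
  qed (simp add: Bernstein_def)
  have "bernform (Suc m) a x
      = a 0 * ((1 - x) * Bernstein m 0 x)
        + (\<Sum>k\<le>m. a (Suc k) * (x * Bernstein m k x + (1 - x) * Bernstein m (Suc k) x))"
    unfolding bernform_def sum.atMost_Suc_shift B0 using BS by simp
  also have "\<dots> = (1 - x) * (a 0 * Bernstein m 0 x + (\<Sum>k\<le>m. a (Suc k) * Bernstein m (Suc k) x))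
                 + x * bernform m (\<lambda>k. a (Suc k)) x"
    unfolding bernform_def
    by (simp add: sum_distrib_left sum.distrib distrib_left mult_ac)
  also have "a 0 * Bernstein m 0 x + (\<Sum>k\<le>m. a (Suc k) * Bernstein m (Suc k) x) = bernform m a x"
    unfolding bernform_def
    using sum.atMost_Suc_shift[of "\<lambda>k. a k * Bernstein m k x" m]
    by (simp add: Bernstein_def[of m "Suc m"] binomial_eq_0)
  finally show ?thesis .
qed

lemma has_real_derivative_bernform:
  "(bernform n a has_real_derivative real n * bernform (n - 1) (fwd_diff a) x) (at x within S)"
proof (induction n arbitrary: a)
  case 0
  have "bernform 0 a = (\<lambda>x. a 0)" by (auto simp: bernform_def Bernstein_def)
  then show ?case by simp
next
  case (Suc m)
  define S' where "S' = (\<lambda>k. a (Suc k))"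
  have diff: "bernform l (fwd_diff b) x = bernform l (\<lambda>k. b (Suc k)) x - bernform l b x" for l b
    using bernform_linear[of l 1 "\<lambda>k. b (Suc k)" "-1" b x] by (simp add: fwd_diff_def[abs_def])
  have step: "real m * bernform m (fwd_diff a) x =
      real m * ((1 - x) * bernform (m - 1) (fwd_diff a) x + x * bernform (m - 1) (fwd_diff S') x)"
    using bernform_Suc[of "m - 1" "fwd_diff a" x]
    by (cases m) (simp_all add: S'_def fwd_diff_def[abs_def])
  have "((\<lambda>x. (1 - x) * bernform m a x + x * bernform m S' x) has_real_derivative
        (1 - x) * (real m * bernform (m - 1) (fwd_diff a) x) - bernform m a x
        + (bernform m S' x + x * (real m * bernform (m - 1) (fwd_diff S') x))) (at x within S)"
    using Suc.IH[of a] Suc.IH[of S'] by (auto intro!: derivative_eq_intros)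
  moreover have "(1 - x) * (real m * bernform (m - 1) (fwd_diff a) x) - bernform m a x
        + (bernform m S' x + x * (real m * bernform (m - 1) (fwd_diff S') x))
      = real (Suc m) * bernform m (fwd_diff a) x"
  proof -
    have "real (Suc m) * bernform m (fwd_diff a) x
        = real m * bernform m (fwd_diff a) x + (bernform m S' x - bernform m a x)"
      unfolding S'_def diff[of m a, symmetric] by (simp add: algebra_simps)
    then show ?thesis unfolding step by (simp add: algebra_simps)
  qed
  moreover have "bernform (Suc m) a = (\<lambda>x. (1 - x) * bernform m a x + x * bernform m S' x)"
    by (auto simp: bernform_Suc S'_def)
  ultimately show ?case by simp
qed

text \<open>
  A within-derivative on \<open>[0, 1]\<close> depends only on the values on \<open>[0, 1]\<close>, so the arbitrary values that
  iterated vector derivatives take elsewhere do no harm.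
\<close>
lemma deriv01_eqI:
  assumes "\<And>i x. x \<in> {0..1} \<Longrightarrow> (D i has_real_derivative D (Suc i) x) (at x within {0..1})"
  assumes "\<And>x. x \<in> {0..1} \<Longrightarrow> g x = D 0 x" and "x \<in> {0..1}"
  shows "deriv01 i g x = D i x"
  using \<open>x \<in> {0..1}\<close>
proof (induction i arbitrary: x)
  case (Suc i)
  have "(deriv01 i g has_vector_derivative D (Suc i) x) (at x within {0..1})"
    using has_vector_derivative_transform[of x "{0..1}" "deriv01 i g" "D i" "D (Suc i) x"]
      Suc assms(1)[of x i] by (simp add: has_real_derivative_iff_has_vector_derivative)
  then show ?case
    using Suc.prems by (auto intro!: vector_derivative_within_closed_interval)
qed (use assms in auto)

lemma deriv01_bernform:
  assumes "\<And>x. x \<in> {0..1} \<Longrightarrow> g x = bernform n a x" and "x \<in> {0..1}"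
  shows "deriv01 s g x = (\<Prod>j<s. real (n - j)) * bernform (n - s) ((fwd_diff ^^ s) a) x"
proof -
  define D where "D i x = (\<Prod>j<i. real (n - j)) * bernform (n - i) ((fwd_diff ^^ i) a) x" for i x
  have "(D i has_real_derivative D (Suc i) x) (at x within {0..1})" for i x
    unfolding D_def
    using DERIV_cmult[OF has_real_derivative_bernform[of "n - i" "(fwd_diff ^^ i) a" x "{0..1}"],
        of "\<Prod>j<i. real (n - j)"]
    by (simp add: mult_ac)
  from deriv01_eqI[of D g x s, OF this] assms show ?thesis by (simp add: D_def)
qed

section \<open>Finite differences, Taylor remainders and the first modulus\<close>

lemma C01_has_derivative:
  assumes "f \<in> C01 s" "i < s" "x \<in> {0..1}"
  shows "(deriv01 i f has_real_derivative deriv01 (Suc i) f x) (at x within {0..1})"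
  using assms unfolding C01_def differentiable_on_def
  by (auto simp: has_real_derivative_iff_has_vector_derivative vector_derivative_works)

text \<open>
  Induction on \<open>s\<close>, applied to \<open>D i (x + h) - D i x\<close>, reduces the difference of order \<open>s + 1\<close> to one
  increment of \<open>D s\<close>, to which the mean value theorem applies.
\<close>
lemma fwd_diff_MVT:
  assumes "\<And>i x. \<lbrakk>i < s; x \<in> {a..b}\<rbrakk> \<Longrightarrow> (D i has_real_derivative D (Suc i) x) (at x within {a..b})"
    and h: "0 < h" and "a \<le> real k * h" "real (k + s) * h \<le> b"
  shows "\<exists>\<xi>\<in>{real k * h..real (k + s) * h}. (fwd_diff ^^ s) (\<lambda>j. D 0 (real j * h)) k = h ^ s * D s \<xi>"
  using assms
proof (induction s arbitrary: D b)
  case 0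
  then show ?case by auto
next
  case (Suc s)
  define E where "E i x = D i (x + h) - D i x" for i x
  have "(E i has_real_derivative E (Suc i) x) (at x within {a..b - h})"
    if "i < s" "x \<in> {a..b - h}" for i x
  proof -
    have 1: "(D i has_real_derivative D (Suc i) x) (at x within {a..b - h})"
      using Suc.prems(1)[of i x] that \<open>0 < h\<close> by (auto elim: DERIV_subset)
    have "(+) h ` {a..b - h} \<subseteq> {a..b}" using h by auto
    then have "(D i has_real_derivative D (Suc i) (h + x)) (at (h + x) within (+) h ` {a..b - h})"
      using Suc.prems(1)[of i "h + x"] that h by (auto elim: DERIV_subset)
    then have "((\<lambda>x. D i (x + h)) has_real_derivative D (Suc i) (x + h)) (at x within {a..b - h})"
      unfolding DERIV_at_within_shift by (simp only: add.commute)
    from DERIV_diff[OF this 1] show ?thesis unfolding E_def .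
  qed
  moreover have "real (k + s) * h \<le> b - h" using Suc.prems(4) by (simp add: algebra_simps)
  ultimately obtain \<xi> where \<xi>: "\<xi> \<in> {real k * h..real (k + s) * h}"
    "(fwd_diff ^^ s) (\<lambda>j. E 0 (real j * h)) k = h ^ s * E s \<xi>"
    using Suc.IH[of "b - h" E] h Suc.prems(3) by blast
  have sub: "{\<xi>..\<xi> + h} \<subseteq> {real k * h..real (k + Suc s) * h}" "{\<xi>..\<xi> + h} \<subseteq> {a..b}"
    using \<xi>(1) Suc.prems(3,4) h by (auto simp: algebra_simps)
  have "(D s has_derivative (*) (D (Suc s) x)) (at x within {\<xi>..\<xi> + h})"
    if "\<xi> \<le> x" "x \<le> \<xi> + h" for x
    using Suc.prems(1)[of s x] that sub(2) unfolding has_field_derivative_def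
    by (auto elim!: has_derivative_subset)
  then obtain \<zeta> where \<zeta>: "\<zeta> \<in> {\<xi>..\<xi> + h}" "E s \<xi> = D (Suc s) \<zeta> * h"
    using mvt_very_simple[of \<xi> "\<xi> + h" "D s" "\<lambda>x. (*) (D (Suc s) x)"] h unfolding E_def by auto
  have "fwd_diff (\<lambda>j. D 0 (real j * h)) = (\<lambda>j. E 0 (real j * h))"
    by (auto simp: fwd_diff_def E_def algebra_simps)
  then have "(fwd_diff ^^ Suc s) (\<lambda>j. D 0 (real j * h)) k = h ^ Suc s * D (Suc s) \<zeta>"
    using \<xi>(2) \<zeta>(2) by (simp add: funpow_swap1 del: funpow.simps) (simp add: funpow_swap1)
  then show ?case using \<zeta>(1) sub(1) by blast
qed

lemma abs_fwd_diff_le: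
  assumes "\<And>j. j \<le> n \<Longrightarrow> \<bar>a j - b j\<bar> \<le> E" and "k + s \<le> n"
  shows "\<bar>(fwd_diff ^^ s) a k - (fwd_diff ^^ s) b k\<bar> \<le> 2 ^ s * E"
  using assms(2)
proof (induction s arbitrary: k)
  case (Suc s)
  have "\<bar>(fwd_diff ^^ s) a (Suc k) - (fwd_diff ^^ s) b (Suc k)\<bar> \<le> 2 ^ s * E"
       "\<bar>(fwd_diff ^^ s) a k - (fwd_diff ^^ s) b k\<bar> \<le> 2 ^ s * E"
    using Suc.IH[of "Suc k"] Suc.IH[of k] Suc.prems by auto
  moreover have "(fwd_diff ^^ Suc s) c k = (fwd_diff ^^ s) c (Suc k) - (fwd_diff ^^ s) c k" for c
    by (simp add: fwd_diff_def[of "(fwd_diff ^^ s) c"])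
  ultimately show ?case by (simp only: power_Suc)
qed (use assms(1) in auto)

text \<open>
  A Taylor estimate with all lower derivatives zero at \<open>c\<close>, obtained by integrating the bound on the
  highest derivative along the segment from \<open>c\<close>. Stated on any convex set, it serves both end points
  of \<open>[0, 1]\<close>.
\<close>
lemma abs_le_of_zero_derivs:
  fixes D :: "nat \<Rightarrow> real \<Rightarrow> real"
  assumes S: "convex S" "c \<in> S"
    and "\<And>i x. \<lbrakk>i < s; x \<in> S\<rbrakk> \<Longrightarrow> (D i has_real_derivative D (Suc i) x) (at x within S)"
    and "\<And>i. i < s \<Longrightarrow> D i c = 0" and "\<And>x. x \<in> S \<Longrightarrow> \<bar>D s x\<bar> \<le> W" and "x \<in> S"
  shows "\<bar>D 0 x\<bar> \<le> \<bar>x - c\<bar> ^ s * W"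
  using assms(3-)
proof (induction s arbitrary: D x)
  case (Suc s)
  have D1: "\<bar>D 1 y\<bar> \<le> \<bar>y - c\<bar> ^ s * W" if "y \<in> S" for y
    using Suc.IH[of "\<lambda>i. D (Suc i)" y] Suc.prems that by auto
  have W: "0 \<le> W" using Suc.prems(3)[OF S(2)] by linarith
  have sub: "closed_segment c x \<subseteq> S" using S Suc.prems(4) by (simp add: closed_segment_subset)
  have "norm (D 0 x - D 0 c) \<le> (\<bar>x - c\<bar> ^ s * W) * norm (x - c)"
  proof (rule field_differentiable_bound)
    fix z assume z: "z \<in> closed_segment c x"
    then show "(D 0 has_real_derivative D 1 z) (at z within closed_segment c x)"
      using Suc.prems(1)[of 0 z] sub DERIV_subset[of "D 0" "D 1 z" z S "closed_segment c x"] by auto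
    have "\<bar>z - c\<bar> \<le> \<bar>x - c\<bar>" using z by (auto simp: closed_segment_eq_real_ivl split: if_splits)
    then have "\<bar>z - c\<bar> ^ s * W \<le> \<bar>x - c\<bar> ^ s * W"
      using W by (intro mult_right_mono power_mono) auto
    then show "norm (D 1 z) \<le> \<bar>x - c\<bar> ^ s * W" using D1[of z] z sub by auto
  qed auto
  then show ?case using Suc.prems(2)[of 0] by (simp add: mult_ac)
qed auto

lemma omega1_upper:
  assumes "continuous_on {0..1} F" "x \<in> {0..1}" "y \<in> {0..1}" "\<bar>x - y\<bar> \<le> t"
  shows "\<bar>F x - F y\<bar> \<le> omega1 F t"
proof -
  obtain M where M: "\<And>x. x \<in> {0..1} \<Longrightarrow> \<bar>F x\<bar> \<le> M"
    using compact_imp_bounded[OF compact_continuous_image[OF assms(1) compact_Icc]]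
    unfolding bounded_iff by (metis imageI real_norm_def)
  have "bdd_above {\<bar>F x - F y\<bar> | x y. x \<in> {0..1} \<and> y \<in> {0..1} \<and> \<bar>x - y\<bar> \<le> t}"
  proof (rule bdd_aboveI)
    fix d assume "d \<in> {\<bar>F x - F y\<bar> | x y. x \<in> {0..1} \<and> y \<in> {0..1} \<and> \<bar>x - y\<bar> \<le> t}"
    then obtain x y where "d = \<bar>F x - F y\<bar>" "x \<in> {0..1}" "y \<in> {0..1}" by blast
    then show "d \<le> M + M" using M[of x] M[of y] by linarith
  qed
  then show ?thesis unfolding omega1_def using assms(2-4) by (intro cSup_upper) auto
qed

lemma omega1_multiple:
  assumes cont: "continuous_on {0..1} F" and "0 \<le> t"
    and "x \<in> {0..1}" "y \<in> {0..1}" "\<bar>x - y\<bar> \<le> real j * t"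
  shows "\<bar>F x - F y\<bar> \<le> real j * omega1 F t"
  using assms(3-)
proof (induction j arbitrary: y)
  case (Suc j)
  \<comment> \<open>Move \<open>y\<close> towards \<open>x\<close> by \<open>t\<close>, stopping at \<open>x\<close>.\<close>
  define z where "z = (if \<bar>x - y\<bar> \<le> t then x else if x \<le> y then y - t else y + t)"
  have "z \<in> {0..1}" "\<bar>z - y\<bar> \<le> t" "\<bar>x - z\<bar> \<le> real j * t"
    using Suc.prems \<open>0 \<le> t\<close> unfolding z_def by (auto simp: algebra_simps)
  then show ?case
    using Suc.IH[of z] omega1_upper[OF cont \<open>z \<in> {0..1}\<close> Suc.prems(2), of t] Suc.prems(1)
    by (simp add: ring_distribs)
qed auto

text \<open>
  The factor that \<open>s\<close> differentiations produce, divided by \<open>n ^ s\<close>, is \<open>1\<close> up to a multiple of \<open>1 / n\<close>.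
  The coefficient \<open>s * (s - 1)\<close> vanishes for \<open>s = 1\<close>: this is why the norm of the derivative enters the
  final estimate only for \<open>s \<ge> 2\<close>.
\<close>
lemma prod_falling_bounds:
  assumes "s \<le> n" "0 < n"
  shows "(\<Prod>j<s. real (n - j)) \<le> real n ^ s"
    and "real n ^ s * (1 - real (s * (s - 1)) / real n) \<le> (\<Prod>j<s. real (n - j))"
proof -
  have le: "(\<Prod>j<r. real (n - j)) \<le> real n ^ r" for r
    using prod_mono[of "{..<r}" "\<lambda>j. real (n - j)" "\<lambda>j. real n"] by simp
  then show "(\<Prod>j<s. real (n - j)) \<le> real n ^ s" .
  show "real n ^ s * (1 - real (s * (s - 1)) / real n) \<le> (\<Prod>j<s. real (n - j))"
    using assms(1)
  proof (induction s)
    case (Suc s)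
    define P where "P = (\<Prod>j<s. real (n - j))"
    have P: "P \<le> real n ^ s" unfolding P_def by (rule le)
    have IH: "real n ^ s * (1 - real (s * (s - 1)) / real n) \<le> P" using Suc by (simp add: P_def)
    have sq: "real (s * (s - 1)) = real s * real s - real s" by (cases s) (auto simp: algebra_simps)
    have "real n ^ Suc s * (1 - real (Suc s * s) / real n)
          \<le> real n * (real n ^ s * (1 - real (s * (s - 1)) / real n)) - real s * real n ^ s"
      unfolding sq using \<open>0 < n\<close> by (simp add: field_simps)
    also have "\<dots> \<le> real n * P - real s * P"
      using IH P by (intro diff_mono mult_left_mono) auto
    also have "\<dots> = (\<Prod>j<Suc s. real (n - j))"
      using Suc.prems by (simp add: P_def of_nat_diff algebra_simps)
    finally show ?case by simp
  qed simp
qed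

section \<open>The error of rounding the coefficients\<close>

lemma norm01_upper:
  assumes "continuous_on {0..1} F" "x \<in> {0..1}"
  shows "\<bar>F x\<bar> \<le> norm01 F"
proof -
  have "bdd_above ((\<lambda>x. \<bar>F x\<bar>) ` {0..1})"
    using assms(1) by (intro bounded_imp_bdd_above compact_imp_bounded compact_continuous_image
        continuous_intros) auto
  then show ?thesis unfolding norm01_def using assms(2) by (intro cSUP_upper)
qed

lemma C01_continuous: "f \<in> C01 s \<Longrightarrow> continuous_on {0..1} (deriv01 s f)"
  by (simp add: C01_def)

text \<open>
  After subtracting the tangent at \<open>c\<close>, all derivatives of order below \<open>s\<close> vanish at \<open>c\<close>, and the one of
  order \<open>s\<close> becomes the increment \<open>deriv01 s f y - deriv01 s f c\<close>: for \<open>s = 1\<close> because of the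
  subtraction, for \<open>s \<ge> 2\<close> because \<open>deriv01 s f c\<close> is zero.
\<close>
lemma endpoint_remainder:
  assumes f: "f \<in> C01 s" and s: "s \<ge> 1" and n: "n > 0" and c: "c \<in> {0..1}"
    and zero: "\<And>i. i \<in> {2..s} \<Longrightarrow> deriv01 i f c = 0"
    and x: "x \<in> {0..1}" "\<bar>x - c\<bar> \<le> real s / real n"
  shows "\<bar>f x - (f c + (x - c) * deriv01 1 f c)\<bar>
           \<le> (real s / real n) ^ s * (real s * omega1 (deriv01 s f) (1 / real n))"
proof -
  define W where "W = real s * omega1 (deriv01 s f) (1 / real n)"
  define S where "S = {0..1} \<inter> {c - real s / real n..c + real s / real n}"
  \<comment> \<open>\<open>T i\<close> is the derivative of order \<open>i\<close> of the tangent of \<open>f\<close> at \<open>c\<close>.\<close>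
  define T where "T i y = (if i = 0 then f c + (y - c) * deriv01 1 f c
                           else if i = 1 then deriv01 1 f c else 0)" for i :: nat and y
  define D where "D i y = deriv01 i f y - T i y" for i y
  have S: "convex S" "c \<in> S" "x \<in> S" "S \<subseteq> {0..1}"
    using c x by (auto simp: S_def abs_le_iff intro!: convex_Int)
  have T: "(T i has_real_derivative T (Suc i) y) (at y within S)" for i y
    unfolding T_def by (cases i) (auto intro!: derivative_eq_intros)
  have deriv: "(D i has_real_derivative D (Suc i) y) (at y within S)" if "i < s" "y \<in> S" for i y
    unfolding D_def using that S(4)
    by (intro DERIV_diff T DERIV_subset[OF C01_has_derivative[OF f]]) auto
  have small: "\<bar>D s y\<bar> \<le> W" if "y \<in> S" for y
  proof -
    have "D s y = deriv01 s f y - deriv01 s f c"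
      using s zero[of s] by (cases "s = 1") (auto simp: D_def T_def)
    then show ?thesis
      using omega1_multiple[OF C01_continuous[OF f], of "1 / real n" y c s] that c
      by (auto simp: W_def S_def)
  qed
  then have W: "0 \<le> W" using S(2) by fastforce
  have "D i c = 0" if "i < s" for i
    using zero[of i] that by (cases i) (auto simp: D_def T_def)
  then have "\<bar>D 0 x\<bar> \<le> \<bar>x - c\<bar> ^ s * W"
    using abs_le_of_zero_derivs[OF S(1,2) deriv _ small S(3)] by blast
  also have "\<dots> \<le> (real s / real n) ^ s * W"
    using W x by (intro mult_right_mono power_mono) auto
  finally show ?thesis by (simp add: D_def T_def W_def)
qed

text \<open>
  The last part is the key to the coefficients near the end points: rounding down never crosses an
  integer lower bound.
\<close>
lemma floor_quotient_bounds:
  fixes v C :: real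
  assumes "C > 0"
  shows "real_of_int \<lfloor>v * C\<rfloor> / C \<le> v" and "v - 1 / C \<le> real_of_int \<lfloor>v * C\<rfloor> / C"
    and "\<lbrakk>l * C \<in> \<int>; l \<le> v\<rbrakk> \<Longrightarrow> l \<le> real_of_int \<lfloor>v * C\<rfloor> / C"
proof -
  show "real_of_int \<lfloor>v * C\<rfloor> / C \<le> v"
    using assms by (simp_all add: field_simps)
  have "(v * C - 1) / C \<le> real_of_int \<lfloor>v * C\<rfloor> / C"
    using assms by (intro divide_right_mono) linarith+
  then show "v - 1 / C \<le> real_of_int \<lfloor>v * C\<rfloor> / C"
    using assms by (simp add: diff_divide_distrib)
  assume "l * C \<in> \<int>" "l \<le> v"
  then obtain z where z: "l * C = of_int z" by (auto elim: Ints_cases)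
  have "l * C \<le> v * C" using \<open>l \<le> v\<close> assms by simp
  then have "z \<le> \<lfloor>v * C\<rfloor>" unfolding z by (simp add: le_floor_iff)
  then show "l \<le> real_of_int \<lfloor>v * C\<rfloor> / C" using z assms by (simp add: pos_le_divide_eq)
qed

lemma binomial_middle_ge:
  assumes "r \<le> k" "k + r \<le> n"
  shows "(real n / real r) ^ r \<le> real (n choose k)"
proof -
  have "(real n / real r) ^ r \<le> real (n choose r)"
    using binomial_ge_n_over_k_pow_k[of r n, where 'a = real] assms by simp
  also have "n choose r \<le> n choose k"
  proof (cases "2 * k \<le> n")
    case False
    then have "n choose r \<le> n choose (n - k)" using assms by (intro binomial_mono) auto
    then show ?thesis using assms by (simp add: binomial_symmetric[of k n])
  qed (use assms binomial_mono in auto)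
  finally show ?thesis by simp
qed

text \<open>
  Away from the ends, for \<open>s < k < n - s\<close>, the binomial coefficient is of order at least \<open>n ^ (s + 1)\<close>, so
  that rounding costs only \<open>O(1 / n ^ (s + 1))\<close>. For the at most \<open>s\<close> coefficients next to an end point the
  binomial coefficient can be as small as \<open>n\<close>. There the tangent value times the binomial coefficient is
  an integer, since \<open>k * (n choose k)\<close> and \<open>(n - k) * (n choose k)\<close> are multiples of \<open>n\<close>; it lies below
  the unrounded coefficient by hypothesis, hence below the rounded one, and the error is at most the
  Taylor remainder. At \<open>k = 0\<close> and \<open>k = n\<close> nothing is rounded.
\<close>
lemma floor_error_bound:
  assumes f: "f \<in> C01 s" and s: "1 \<le> s" "s \<le> n"
    and int: "f 0 \<in> \<int>" "f 1 \<in> \<int>" "deriv01 1 f 0 \<in> \<int>" "deriv01 1 f 1 \<in> \<int>"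
    and zero: "\<And>i. i \<in> {2..s} \<Longrightarrow> deriv01 i f 0 = 0 \<and> deriv01 i f 1 = 0"
    and left: "\<And>k. k \<in> {1..s} \<Longrightarrow> f (real k / real n) \<ge> f 0 + real k / real n * deriv01 1 f 0"
    and right: "\<And>k. k \<in> {n - s..n - 1} \<Longrightarrow> f (real k / real n) \<ge> f 1 - (1 - real k / real n) * deriv01 1 f 1"
    and k: "k \<le> n"
  shows "\<bar>real_of_int \<lfloor>f (real k / real n) * real (n choose k)\<rfloor> / real (n choose k) - f (real k / real n)\<bar>
     \<le> (real s ^ Suc s * omega1 (deriv01 s f) (1 / real n) + real (Suc s) ^ Suc s / real n) / real n ^ s"
    (is "?err \<le> ?E")
proof -
  define W where "W = omega1 (deriv01 s f) (1 / real n)"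
  have n: "0 < n" using s by simp
  have C: "0 < real (n choose k)" using k by simp
  note bounds = floor_quotient_bounds[OF C, where v = "f (real k / real n)"]
  have k01: "real k / real n \<in> {0..1}" using k n by auto
  have W: "0 \<le> W"
    using omega1_upper[OF C01_continuous[OF f], of 0 0 "1 / real n"] by (simp add: W_def)
  have E1: "(real s / real n) ^ s * (real s * W) \<le> ?E"
    using n by (simp add: W_def[symmetric] power_divide divide_right_mono)
  consider "k = 0" | "k = n" | "1 \<le> k" "k \<le> s" "k < n" | "k < n" "n - s \<le> k" | "Suc s \<le> k" "k + Suc s \<le> n"
    using k by linarith
  then show ?thesis
  proof cases
    case 3
    have "real k * real (n choose k) = real n * real ((n - 1) choose (k - 1))"
      unfolding of_nat_mult[symmetric] using 3 by (simp add: times_binomial_minus1_eq)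
    then have "(f 0 + real k / real n * deriv01 1 f 0) * real (n choose k)
        = f 0 * real (n choose k) + deriv01 1 f 0 * real ((n - 1) choose (k - 1))"
      using n by (simp add: field_simps)
    then have "(f 0 + real k / real n * deriv01 1 f 0) * real (n choose k) \<in> \<int>" using int by simp
    from bounds(1) bounds(3)[OF this left] 3
    have "?err \<le> \<bar>f (real k / real n) - (f 0 + (real k / real n - 0) * deriv01 1 f 0)\<bar>" by auto
    also have "\<dots> \<le> (real s / real n) ^ s * (real s * W)"
      unfolding W_def using 3 n k01 zero
      by (intro endpoint_remainder[OF f s(1) n]) (auto simp: divide_right_mono)
    finally show ?thesis using E1 by linarith
  next
    case 4
    have "real (n - k) * real (n choose k) = real n * real ((n - 1) choose k)"
      unfolding of_nat_mult[symmetric] by (simp only: binomial_absorb_comp)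
    then have "(1 - real k / real n) * real (n choose k) = real ((n - 1) choose k)"
      using n 4 by (simp add: of_nat_diff field_simps)
    then have "(f 1 - (1 - real k / real n) * deriv01 1 f 1) * real (n choose k)
        = f 1 * real (n choose k) - deriv01 1 f 1 * real ((n - 1) choose k)"
      by (metis left_diff_distrib mult.assoc mult.commute)
    then have "(f 1 - (1 - real k / real n) * deriv01 1 f 1) * real (n choose k) \<in> \<int>" using int by simp
    moreover have "k \<in> {n - s..n - 1}" using 4 by auto
    ultimately have
      "f 1 - (1 - real k / real n) * deriv01 1 f 1
         \<le> real_of_int \<lfloor>f (real k / real n) * real (n choose k)\<rfloor> / real (n choose k)"
      using bounds(3) right by blast
    moreover have "(1 - real k / real n) * deriv01 1 f 1 = - ((real k / real n - 1) * deriv01 1 f 1)"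
      by (simp only: left_diff_distrib)
    ultimately have "?err \<le> \<bar>f (real k / real n) - (f 1 + (real k / real n - 1) * deriv01 1 f 1)\<bar>"
      using bounds(1) by linarith
    also have "\<dots> \<le> (real s / real n) ^ s * (real s * W)"
      unfolding W_def
    proof (intro endpoint_remainder[OF f s(1) n])
      show "\<bar>real k / real n - 1\<bar> \<le> real s / real n"
      proof -
        have "(real n - real k) / real n \<le> real s / real n"
          using 4 by (intro divide_right_mono) linarith+
        then show ?thesis using k01 n by (simp add: diff_divide_distrib)
      qed
    qed (use k01 zero in auto)
    finally show ?thesis using E1 by linarith
  next
    case 5
    have "?err \<le> 1 / real (n choose k)" using bounds(1,2) by linarith
    also have "\<dots> \<le> 1 / (real n / real (Suc s)) ^ Suc s"
      using 5 n by (intro divide_left_mono binomial_middle_ge mult_pos_pos) auto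
    also have "\<dots> = real (Suc s) ^ Suc s / real n / real n ^ s"
      using n by (simp add: power_divide)
    also have "\<dots> \<le> ?E" using W n by (intro divide_right_mono) (auto simp: W_def)
    finally show ?thesis .
  next
    case 1
    then have "?err = 0" using int by (auto elim!: Ints_cases)
    also have "\<dots> \<le> ?E" using W by (simp add: W_def)
    finally show ?thesis .
  next
    case 2
    then have "?err = 0" using int n by (auto elim!: Ints_cases)
    also have "\<dots> \<le> ?E" using W by (simp add: W_def)
    finally show ?thesis .
  qed
qed

section \<open>The derivatives of the integer Bernstein polynomial\<close>

text \<open>
  The forward difference is \<open>1 / n ^ s\<close> times the derivative at some \<open>\<xi>\<close> between \<open>k / n\<close> and \<open>(k + s) / n\<close>. The node
  \<open>k / (n - s)\<close> of the Bernstein operator of degree \<open>n - s\<close> lies in the same interval of length \<open>s / n\<close>.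
  For \<open>n = s\<close> only \<open>k = 0\<close> occurs and \<open>real k / real (n - s) = 0\<close>, again a point of that interval.
\<close>
lemma fwd_diff_vs_derivative:
  assumes f: "f \<in> C01 s" and s: "s \<le> n" "0 < n" and k: "k \<le> n - s"
  shows "\<bar>(\<Prod>j<s. real (n - j)) * (fwd_diff ^^ s) (\<lambda>j. f (real j / real n)) k
            - deriv01 s f (real k / real (n - s))\<bar>
         \<le> real (s * (s - 1)) / real n * norm01 (deriv01 s f)
            + real s * omega1 (deriv01 s f) (1 / real n)"
proof -
  define P where "P = (\<Prod>j<s. real (n - j))"
  define F where "F = deriv01 s f"
  have cont: "continuous_on {0..1} F" unfolding F_def by (rule C01_continuous[OF f])
  have ks: "real (k + s) \<le> real n" using k s by linarith
  have k01: "real (k + s) * (1 / real n) \<le> 1" using ks s by simp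
  have "\<exists>\<xi>\<in>{real k * (1 / real n)..real (k + s) * (1 / real n)}.
      (fwd_diff ^^ s) (\<lambda>j. deriv01 0 f (real j * (1 / real n))) k = (1 / real n) ^ s * deriv01 s f \<xi>"
    using s by (intro fwd_diff_MVT[where a = 0 and b = 1] C01_has_derivative[OF f] k01) auto
  then obtain \<xi> where \<xi>: "\<xi> \<in> {real k / real n..real (k + s) / real n}"
    and eq: "(fwd_diff ^^ s) (\<lambda>j. f (real j / real n)) k = F \<xi> / real n ^ s"
    by (auto simp: F_def power_divide)
  have "0 \<le> \<xi>" "\<xi> \<le> 1"
    using \<xi> k01 order_trans[of 0 "real k / real n" \<xi>] by auto
  then have \<xi>01: "\<xi> \<in> {0..1}" by simp
  define y where "y = real k / real (n - s)"
  have y01: "y \<in> {0..1}" using k by (cases "n = s") (auto simp: y_def divide_le_eq_1)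
  have y: "y \<in> {real k / real n..real (k + s) / real n}"
  proof (cases "n = s")
    case False
    then have pos: "0 < real (n - s)" "real (n - s) = real n - real s" using s by auto
    have "real k / real n \<le> y" unfolding y_def using pos by (intro divide_left_mono) auto
    moreover have "y \<le> real (k + s) / real n"
    proof -
      have "real s * real k \<le> real s * (real n - real s)" using ks by (intro mult_left_mono) auto
      then have "real k * real n \<le> real (k + s) * (real n - real s)" by (simp add: algebra_simps)
      then show ?thesis unfolding y_def pos(2) using pos s by (simp add: field_simps)
    qed
    ultimately show ?thesis by simp
  qed (use k in \<open>simp add: y_def\<close>)
  have "\<bar>\<xi> - y\<bar> \<le> real s * (1 / real n)"
    using \<xi> y by (auto simp: add_divide_distrib abs_le_iff)
  then have near: "\<bar>F \<xi> - F y\<bar> \<le> real s * omega1 F (1 / real n)"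
    by (intro omega1_multiple[OF cont] \<xi>01 y01) auto
  have pos: "0 < real n ^ s" using s by simp
  have "P / real n ^ s \<le> 1" "1 - real (s * (s - 1)) / real n \<le> P / real n ^ s"
    using prod_falling_bounds[OF s] pos unfolding P_def[symmetric] by (simp_all add: field_simps)
  then have "\<bar>P / real n ^ s - 1\<bar> \<le> real (s * (s - 1)) / real n" by linarith
  then have "\<bar>P / real n ^ s - 1\<bar> * \<bar>F \<xi>\<bar> \<le> real (s * (s - 1)) / real n * norm01 F"
    by (intro mult_mono norm01_upper[OF cont \<xi>01]) auto
  moreover have "P * (F \<xi> / real n ^ s) - F y = (P / real n ^ s - 1) * F \<xi> + (F \<xi> - F y)"
    by (simp add: algebra_simps)
  ultimately show ?thesis
    using near abs_triangle_ineq[of "(P / real n ^ s - 1) * F \<xi>" "F \<xi> - F y"]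
    unfolding eq P_def[symmetric] F_def[symmetric] y_def[symmetric]
    by (simp only: abs_mult)
qed

text \<open>
  The scale \<open>n powr (- 1 / 2)\<close> belongs to degree \<open>n\<close> while the operator has degree \<open>n - s\<close>; the ratio
  \<open>n / (n - s)\<close> is at most \<open>s + 1\<close> unless \<open>n = s\<close>. In that case the operator returns the constant \<open>F 0\<close>,
  and \<open>s\<close> steps of length \<open>1 / n\<close> span the interval, so the first modulus suffices.
\<close>
lemma bernform_derivative_approx:
  assumes cont: "continuous_on {0..1} F" and s: "s \<le> n" "0 < n" and x: "x \<in> {0..1}"
  shows "\<bar>bernform (n - s) (\<lambda>k. F (real k / real (n - s))) x - F x\<bar>
          \<le> (real s + 2) * omega2_phi F (real n powr (- 1 / 2)) + real s * omega1 F (1 / real n)"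
proof -
  define t where "t = real n powr (- 1 / 2)"
  have t: "0 < t" "t\<^sup>2 = 1 / real n"
    using s by (auto simp: t_def power2_eq_square powr_add[symmetric] powr_minus_divide)
  have o1: "0 \<le> omega1 F (1 / real n)" using omega1_upper[OF cont, of 0 0 "1 / real n"] by simp
  have o2: "0 \<le> omega2_phi F t"
    using omega2_phi_upper[OF cont, of t t 0] t by (simp add: phi_def)
  show ?thesis
  proof (cases "n = s")
    case True
    have "\<bar>F 0 - F x\<bar> \<le> real n * omega1 F (1 / real n)"
      using x s by (intro omega1_multiple[OF cont]) auto
    moreover have "bernform (n - s) (\<lambda>k. F (real k / real (n - s))) x = F 0"
      using True by (simp add: bernform_def Bernstein_def)
    moreover have "0 \<le> (real s + 2) * omega2_phi F t" using o2 by simp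
    ultimately show ?thesis using True unfolding t_def[symmetric] by simp
  next
    case False
    then have m: "0 < n - s" using s by simp
    have "real s * 1 \<le> real s * real (n - s)" using m by (intro mult_left_mono) auto
    then have "real n \<le> (real s + 1) * real (n - s)" using s m by (simp add: of_nat_diff algebra_simps)
    then have "1 / (real (n - s) * t\<^sup>2) \<le> real s + 1" using m s by (simp add: t divide_simps)
    then have "(1 + 1 / (real (n - s) * t\<^sup>2)) * omega2_phi F t \<le> (real s + 2) * omega2_phi F t"
      using o2 by (intro mult_right_mono) auto
    moreover have "0 \<le> real s * omega1 F (1 / real n)" using o1 by simp
    ultimately show ?thesis
      using bernform_ditzian_totik[OF cont t(1) m x] unfolding t_def[symmetric] by linarith
  qed
qed

lemma int_Bernstein_eq_bernform:
  "int_Bernstein n f x =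
     bernform n (\<lambda>k. real_of_int \<lfloor>f (real k / real n) * real (n choose k)\<rfloor> / real (n choose k)) x"
  unfolding int_Bernstein_def bernform_def Bernstein_def atMost_atLeast0
  by (intro sum.cong) auto

text \<open>
  Three errors add up: rounding (the summand with \<open>E\<close>), replacing finite differences by derivatives at
  the nodes, and the approximation of \<open>deriv01 s f\<close> by its own Bernstein polynomial of degree \<open>n - s\<close>.
\<close>
lemma int_Bernstein_deriv_error:
  assumes f: "f \<in> C01 s" and s: "1 \<le> s" "s \<le> n"
    and int: "f 0 \<in> \<int>" "f 1 \<in> \<int>" "deriv01 1 f 0 \<in> \<int>" "deriv01 1 f 1 \<in> \<int>"
    and zero: "\<And>i. i \<in> {2..s} \<Longrightarrow> deriv01 i f 0 = 0 \<and> deriv01 i f 1 = 0"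
    and left: "\<And>k. k \<in> {1..s} \<Longrightarrow> f (real k / real n) \<ge> f 0 + real k / real n * deriv01 1 f 0"
    and right: "\<And>k. k \<in> {n - s..n - 1} \<Longrightarrow> f (real k / real n) \<ge> f 1 - (1 - real k / real n) * deriv01 1 f 1"
    and x: "x \<in> {0..1}"
  shows "\<bar>deriv01 s (int_Bernstein n f) x - deriv01 s f x\<bar>
     \<le> (real s + 2) * omega2_phi (deriv01 s f) (real n powr (- 1 / 2))
       + (2 ^ s * real s ^ Suc s + 2 * real s) * omega1 (deriv01 s f) (1 / real n)
       + real (s * (s - 1)) / real n * norm01 (deriv01 s f)
       + 2 ^ s * real (Suc s) ^ Suc s / real n"
proof -
  define F where "F = deriv01 s f"
  define b where "b k = f (real k / real n)" for k
  define a where "a k = real_of_int \<lfloor>b k * real (n choose k)\<rfloor> / real (n choose k)" for k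
  define P where "P = (\<Prod>j<s. real (n - j))"
  define E where "E = real s ^ Suc s * omega1 F (1 / real n) + real (Suc s) ^ Suc s / real n"
  have n: "0 < n" using s by simp
  have P: "0 \<le> P" "P \<le> real n ^ s"
    using prod_falling_bounds(1)[OF s(2) n] by (auto simp: P_def intro: prod_nonneg)
  have deriv: "deriv01 s (int_Bernstein n f) x = bernform (n - s) (\<lambda>k. P * (fwd_diff ^^ s) a k) x"
    using deriv01_bernform[OF int_Bernstein_eq_bernform x, of s n f]
      bernform_linear[of "n - s" P "(fwd_diff ^^ s) a" 0 "(fwd_diff ^^ s) a" x]
    by (simp add: a_def[abs_def] b_def P_def)
  have E: "0 \<le> E"
    using omega1_upper[OF C01_continuous[OF f], of 0 0 "1 / real n"] by (simp add: E_def F_def)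
  have floor_err: "\<bar>P * (fwd_diff ^^ s) a k - P * (fwd_diff ^^ s) b k\<bar> \<le> 2 ^ s * E" if "k \<le> n - s" for k
  proof -
    have "\<bar>a j - b j\<bar> \<le> E / real n ^ s" if "j \<le> n" for j
      unfolding a_def b_def E_def F_def
      by (intro floor_error_bound[OF f s int zero left right that])
    then have "\<bar>(fwd_diff ^^ s) a k - (fwd_diff ^^ s) b k\<bar> \<le> 2 ^ s * (E / real n ^ s)"
      using that s by (intro abs_fwd_diff_le[of n]) auto
    then have "P * \<bar>(fwd_diff ^^ s) a k - (fwd_diff ^^ s) b k\<bar> \<le> real n ^ s * (2 ^ s * (E / real n ^ s))"
      using P E by (intro mult_mono) auto
    then show ?thesis using n P by (simp add: abs_mult flip: right_diff_distrib)
  qed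
  have "\<bar>bernform (n - s) (\<lambda>k. P * (fwd_diff ^^ s) a k) x - bernform (n - s) (\<lambda>k. F (real k / real (n - s))) x\<bar>
      \<le> 2 ^ s * E + (real (s * (s - 1)) / real n * norm01 F + real s * omega1 F (1 / real n))"
  proof (rule abs_bernform_diff_le[OF x])
    fix k assume k: "k \<le> n - s"
    have "\<bar>P * (fwd_diff ^^ s) b k - F (real k / real (n - s))\<bar>
        \<le> real (s * (s - 1)) / real n * norm01 F + real s * omega1 F (1 / real n)"
      using fwd_diff_vs_derivative[OF f s(2) n k] unfolding P_def F_def b_def[abs_def] .
    with floor_err[OF k]
    show "\<bar>P * (fwd_diff ^^ s) a k - F (real k / real (n - s))\<bar>
        \<le> 2 ^ s * E + (real (s * (s - 1)) / real n * norm01 F + real s * omega1 F (1 / real n))"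
      by linarith
  qed
  moreover have "\<bar>bernform (n - s) (\<lambda>k. F (real k / real (n - s))) x - F x\<bar>
      \<le> (real s + 2) * omega2_phi F (real n powr (- 1 / 2)) + real s * omega1 F (1 / real n)"
    unfolding F_def by (intro bernform_derivative_approx C01_continuous[OF f] s n x)
  moreover have "2 ^ s * E = 2 ^ s * real s ^ Suc s * omega1 F (1 / real n)
      + 2 ^ s * real (Suc s) ^ Suc s / real n"
    unfolding E_def by (simp only: distrib_left) simp
  moreover have "(2 ^ s * real s ^ Suc s + 2 * real s) * omega1 F (1 / real n)
      = 2 ^ s * real s ^ Suc s * omega1 F (1 / real n) + 2 * (real s * omega1 F (1 / real n))"
    by (simp only: distrib_right mult.assoc)
  ultimately show ?thesis unfolding deriv F_def[symmetric] by linarith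
qed

theorem theorem1p1:
  fixes s :: nat
  assumes "s \<ge> 1"
  shows "\<exists>c::real. c > 0 \<and>
    (\<forall>(f :: real \<Rightarrow> real) (n\<^sub>0 :: nat).
       f \<in> C01 s \<longrightarrow>
       f 0 \<in> \<int> \<longrightarrow> f 1 \<in> \<int> \<longrightarrow> deriv01 1 f 0 \<in> \<int> \<longrightarrow> deriv01 1 f 1 \<in> \<int> \<longrightarrow>
       (\<forall>i\<in>{2..s}. deriv01 i f 0 = 0 \<and> deriv01 i f 1 = 0) \<longrightarrow>
       n\<^sub>0 \<ge> 1 \<longrightarrow> n\<^sub>0 \<ge> s \<longrightarrow>
       (\<forall>n\<ge>n\<^sub>0. \<forall>k\<in>{1..s}.
          f (real k / real n) \<ge> f 0 + real k / real n * deriv01 1 f 0) \<longrightarrow>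
       (\<forall>n\<ge>n\<^sub>0. \<forall>k\<in>{n - s..n - 1}.
          f (real k / real n) \<ge> f 1 - (1 - real k / real n) * deriv01 1 f 1) \<longrightarrow>
       (\<forall>n\<ge>n\<^sub>0.
          (s = 1 \<longrightarrow>
             norm01 (\<lambda>x. deriv01 1 (int_Bernstein n f) x - deriv01 1 f x)
               \<le> c * (omega2_phi (deriv01 1 f) (real n powr (- 1 / 2))
                      + omega1 (deriv01 1 f) (1 / real n) + 1 / real n)) \<and>
          (s \<ge> 2 \<longrightarrow>
             norm01 (\<lambda>x. deriv01 s (int_Bernstein n f) x - deriv01 s f x)
               \<le> c * (omega2_phi (deriv01 s f) (real n powr (- 1 / 2))
                      + omega1 (deriv01 s f) (1 / real n)
                      + 1 / real n * norm01 (deriv01 s f) + 1 / real n))))"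
proof -
  define c :: real where
    "c = (real s + 2) + (2 ^ s * real s ^ Suc s + 2 * real s) + real (s * (s - 1)) + 2 ^ s * real (Suc s) ^ Suc s"
  have c: "0 < c" unfolding c_def by (intro add_nonneg_pos) auto
  have coeffs: "real s + 2 \<le> c" "2 ^ s * real s ^ Suc s + 2 * real s \<le> c"
    "real (s * (s - 1)) \<le> c" "2 ^ s * real (Suc s) ^ Suc s \<le> c"
    unfolding c_def by (auto intro!: add_nonneg_nonneg)
  show ?thesis
  proof (intro exI[of _ c] conjI c allI impI)
    fix f :: "real \<Rightarrow> real" and n0 n :: nat
    assume f: "f \<in> C01 s" and int: "f 0 \<in> \<int>" "f 1 \<in> \<int>" "deriv01 1 f 0 \<in> \<int>" "deriv01 1 f 1 \<in> \<int>"
      and zero: "\<forall>i\<in>{2..s}. deriv01 i f 0 = 0 \<and> deriv01 i f 1 = 0"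
      and n0: "n0 \<ge> 1" "n0 \<ge> s" "n \<ge> n0"
      and left: "\<forall>n\<ge>n0. \<forall>k\<in>{1..s}. f (real k / real n) \<ge> f 0 + real k / real n * deriv01 1 f 0"
      and right: "\<forall>n\<ge>n0. \<forall>k\<in>{n - s..n - 1}. f (real k / real n) \<ge> f 1 - (1 - real k / real n) * deriv01 1 f 1"
    define F where "F = deriv01 s f"
    \<comment> \<open>The norm term is absent for \<open>s = 1\<close>; with this \<open>N\<close> both cases are instances of one bound.\<close>
    define N where "N = (if s = 1 then 0 else 1 / real n * norm01 F)"
    have cont: "continuous_on {0..1} F" unfolding F_def by (rule C01_continuous[OF f])
    have o1: "0 \<le> omega1 F (1 / real n)" using omega1_upper[OF cont, of 0 0 "1 / real n"] by simp
    have o2: "0 \<le> omega2_phi F (real n powr (- 1 / 2))"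
      using omega2_phi_upper[OF cont, of "real n powr (- 1 / 2)" "real n powr (- 1 / 2)" 0] n0
      by (simp add: phi_def)
    have N: "0 \<le> N" "real (s * (s - 1)) / real n * norm01 F = real (s * (s - 1)) * N"
      using norm01_upper[OF cont, of 0] by (auto simp: N_def)
    have "norm01 (\<lambda>x. deriv01 s (int_Bernstein n f) x - deriv01 s f x)
        \<le> c * (omega2_phi F (real n powr (- 1 / 2)) + omega1 F (1 / real n) + N + 1 / real n)"
      unfolding norm01_def
    proof (rule cSUP_least)
      fix x :: real assume x: "x \<in> {0..1}"
      have "\<bar>deriv01 s (int_Bernstein n f) x - deriv01 s f x\<bar>
        \<le> (real s + 2) * omega2_phi F (real n powr (- 1 / 2))
          + (2 ^ s * real s ^ Suc s + 2 * real s) * omega1 F (1 / real n)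
          + real (s * (s - 1)) * N
          + 2 ^ s * real (Suc s) ^ Suc s * (1 / real n)"
        using int_Bernstein_deriv_error[OF f assms _ int _ _ _ x, of n] zero left right n0 N(2)
        unfolding F_def[symmetric] by auto
      also have "\<dots> \<le> c * omega2_phi F (real n powr (- 1 / 2)) + c * omega1 F (1 / real n)
          + c * N + c * (1 / real n)"
        using o1 o2 N(1) coeffs by (intro add_mono mult_right_mono) auto
      finally show "\<bar>deriv01 s (int_Bernstein n f) x - deriv01 s f x\<bar>
        \<le> c * (omega2_phi F (real n powr (- 1 / 2)) + omega1 F (1 / real n) + N + 1 / real n)"
        by (simp only: distrib_left)
    qed simp
    note bound = this
    show "norm01 (\<lambda>x. deriv01 1 (int_Bernstein n f) x - deriv01 1 f x)
       \<le> c * (omega2_phi (deriv01 1 f) (real n powr (- 1 / 2))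
              + omega1 (deriv01 1 f) (1 / real n) + 1 / real n)" if "s = 1"
      using bound unfolding that F_def N_def by simp
    show "norm01 (\<lambda>x. deriv01 s (int_Bernstein n f) x - deriv01 s f x)
       \<le> c * (omega2_phi (deriv01 s f) (real n powr (- 1 / 2))
              + omega1 (deriv01 s f) (1 / real n)
              + 1 / real n * norm01 (deriv01 s f) + 1 / real n)" if "s \<ge> 2"
      using bound that unfolding F_def N_def by simp
  qed
qed

end
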